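(* Let $P$ be an $n\times n$ pattern with term-rank $n$ in standard form. If every real matrix with pattern $P$ has all of its singular values of multiplicity $1$, then the digraph of $P$ is a weak path.
   Context: A pattern is a matrix with entries in $\{0,1\}$; a real matrix has pattern $P$ if its $(i,j)$ entry is nonzero exactly when $p_{ij}=1$. The term-rank is the largest number of nonzero entries with no two in the same row or column. An $n\times n$ pattern is in standard form if all its diagonal entries are $1$. Its digraph has vertices $1,\dots,n$ and an arc from $i$ to $j$ iff $i\neq j$ and $p_{ij}=1$. A digraph is a weak path if its underlying (undirected) graph, obtained by ignoring directions of arcs, is a path. The singular values of a real $n\times n$ matrix $A$ are the nonnegative square roots of the eigenvalues of $AA^T$, with multiplicity. *)

theory Defs
  imports
    "Jordan_Normal_Form.Char_Poly"
    "Graph_Theory.Digraph_Component"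
begin

(* Rows, columns and vertices are numbered 0, ..., n - 1, as in Jordan_Normal_Form. *)

definition is_pattern :: "nat mat \<Rightarrow> bool" where
  "is_pattern P \<longleftrightarrow> elements_mat P \<subseteq> {0, 1}"

definition has_pattern :: "real mat \<Rightarrow> nat mat \<Rightarrow> bool" where
  "has_pattern A P \<longleftrightarrow> A \<in> carrier_mat (dim_row P) (dim_col P) \<and>
     (\<forall>i < dim_row P. \<forall>j < dim_col P. A $$ (i, j) \<noteq> 0 \<longleftrightarrow> P $$ (i, j) = 1)"

(* inj_on fst / inj_on snd: no two of the chosen positions lie in the same row / column. *)
definition term_rank :: "'a :: zero mat \<Rightarrow> nat" where
  "term_rank P = Max {card S | S.
     S \<subseteq> {(i, j). i < dim_row P \<and> j < dim_col P \<and> P $$ (i, j) \<noteq> 0} \<and>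
     inj_on fst S \<and> inj_on snd S}"

definition standard_form :: "nat mat \<Rightarrow> bool" where
  "standard_form P \<longleftrightarrow> square_mat P \<and> (\<forall>i < dim_row P. P $$ (i, i) = 1)"

definition pattern_digraph :: "nat mat \<Rightarrow> nat pair_pre_digraph" where
  "pattern_digraph P = \<lparr> pverts = {..<dim_row P},
     parcs = {(i, j). i < dim_row P \<and> j < dim_row P \<and> i \<noteq> j \<and> P $$ (i, j) = 1} \<rparr>"

(* For an undirected graph, represented by a symmetric digraph: the vertices can be listed
   without repetition so that the adjacent pairs are exactly the consecutive ones. A single
   vertex is a path; the empty graph is not. *)
definition path_graph :: "'a pair_pre_digraph \<Rightarrow> bool" where
  "path_graph G \<longleftrightarrow> (\<exists>vs. vs \<noteq> [] \<and> distinct vs \<and> set vs = pverts G \<and>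
     parcs G = {(vs ! i, vs ! j) | i j.
       i < length vs \<and> j < length vs \<and> (j = Suc i \<or> i = Suc j)})"

(* mk_symmetric is the underlying undirected graph: u and v are adjacent iff there is an arc
   from u to v or from v to u. A pair of opposite arcs gives a single edge. *)
definition weak_path :: "('a, 'b) pre_digraph \<Rightarrow> bool" where
  "weak_path D \<longleftrightarrow> path_graph (mk_symmetric D)"

(* The multiset proots p contains each root of p as often as its order. *)
definition singular_values :: "real mat \<Rightarrow> real multiset" where
  "singular_values A = image_mset sqrt (proots (char_poly (A * transpose_mat A)))"

end

(* Suppose S is a symmetric matrix supported on the bipartite graph B of P (rows on one side,
   columns on the other), d is a positive vector, and S f = d f, S g = d g for two independent
   vectors f, g. Rescaling the entries of S by 1 / sqrt (d u * d v) gives a matrix with pattern P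
   whose singular value 1 is at least double. Such data exist in three situations.
   - B is disconnected: take S the adjacency matrix and d the degrees; every indicator of a union
     of components works.
   - Some edge pq of B is not a bridge: take f and g harmonic (with killing) off {p, q}, with
     boundary values (1, 0) and (0, 1). The net flow they produce at q and p is the same positive
     number c, and giving the edge pq the weight -c cancels it.
   - Some vertex v of B has three branches with at least one edge each: combinations of the
     branches' constant vectors that cancel at v form a space of dimension two.
   Otherwise B is connected and all its edges are bridges. Contracting the matching of the diagonal
   entries, the underlying graph of the digraph is connected, all its edges are bridges, and it has
   no vertex of degree three, so a longest path exhausts it. *)
theory Submission
  imports Defs
begin

section \<open>Double eigenvalues\<close>

text \<open>\<open>X\<close> times the derivative of the characteristic polynomial is the sum, over
  \<open>k\<close>, of the characteristic polynomials of \<open>M\<close> with row and column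
  \<open>k\<close> zeroed. Each of these matrices keeps the eigenvalue \<open>e\<close>, because the
  plane spanned by \<open>u\<close> and \<open>u'\<close> contains a nonzero vector vanishing at
  \<open>k\<close>. Since \<open>e\<close> is nonzero, it is a root of the derivative too.\<close>

lemma two_le_order_char_poly:
  fixes M :: "'a :: field_char_0 mat"
  assumes M: "M \<in> carrier_mat n n" and e: "e \<noteq> 0"
    and u: "u \<in> carrier_vec n" "M *\<^sub>v u = e \<cdot>\<^sub>v u"
    and u': "u' \<in> carrier_vec n" "M *\<^sub>v u' = e \<cdot>\<^sub>v u'"
    and ij: "i < n" "j < n" "u $ i * u' $ j \<noteq> u $ j * u' $ i"
  shows "2 \<le> order e (char_poly M)"
proof -
  let ?p = "char_poly M"
  have u0: "u \<noteq> 0\<^sub>v n"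
    using ij by auto
  have "poly ?p e = 0"
    using M u u0 unfolding eigenvalue_root_char_poly[OF M, symmetric] eigenvalue_def eigenvector_def
    by auto
  have deg: "degree ?p = n" and "?p \<noteq> 0"
    using degree_monic_char_poly[OF M] by auto
  have "pderiv ?p \<noteq> 0"
    using deg ij(1) by (auto simp: pderiv_eq_0_iff)
  have "poly (char_poly (mat_erase M k k)) e = 0" if k: "k < n" for k
  proof -
    have "\<exists>w. w \<in> carrier_vec n \<and> w \<noteq> 0\<^sub>v n \<and> M *\<^sub>v w = e \<cdot>\<^sub>v w \<and> w $ k = 0"
    proof (cases "u $ k = 0 \<and> u' $ k = 0")
      case True
      then show ?thesis using u u0 by auto
    next
      case False
      define w where "w = u' $ k \<cdot>\<^sub>v u - u $ k \<cdot>\<^sub>v u'"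
      \<comment> \<open>If \<open>w\<close> were 0, then \<open>u' $ k\<close> times
        \<open>u\<close> would equal \<open>u $ k\<close> times \<open>u'\<close>. Each of these
        coefficients times the nonzero minor at \<open>i\<close>, \<open>j\<close> is then 0, so
        both vanish, contrary to the case.\<close>
      have "w \<noteq> 0\<^sub>v n"
      proof
        assume "w = 0\<^sub>v n"
        then have "w $ l = 0" if "l < n" for l
          using that by simp
        then have "u' $ k * u $ l = u $ k * u' $ l" if "l < n" for l
          using that u(1) u'(1) unfolding w_def by simp
        note eqs = this[OF ij(1)] this[OF ij(2)]
        have "u' $ k * (u $ i * u' $ j - u $ j * u' $ i)
            = (u' $ k * u $ i) * u' $ j - (u' $ k * u $ j) * u' $ i"
          by (simp add: algebra_simps)
        then have "u' $ k * (u $ i * u' $ j - u $ j * u' $ i) = 0"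
          unfolding eqs by (simp add: algebra_simps)
        moreover have "u $ k * (u $ i * u' $ j - u $ j * u' $ i)
            = u $ i * (u $ k * u' $ j) - u $ j * (u $ k * u' $ i)"
          by (simp add: algebra_simps)
        then have "u $ k * (u $ i * u' $ j - u $ j * u' $ i) = 0"
          unfolding eqs[symmetric] by (simp add: algebra_simps)
        ultimately show False
          using False ij(3) by auto
      qed
      moreover have "M *\<^sub>v w = e \<cdot>\<^sub>v w"
        using M u u' unfolding w_def
        by (subst mult_minus_distrib_mat_vec[of _ n n])
           (auto simp: mult_mat_vec[of _ n n] algebra_simps intro!: eq_vecI)
      ultimately show ?thesis
        using u(1) u'(1) k by (intro exI[of _ w]) (auto simp: w_def)
    qed
    then obtain w where w: "w \<in> carrier_vec n" "w \<noteq> 0\<^sub>v n" "M *\<^sub>v w = e \<cdot>\<^sub>v w" "w $ k = 0"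
      by auto
    have "mat_erase M k k *\<^sub>v w = e \<cdot>\<^sub>v w"
    proof (rule eq_vecI)
      fix l
      assume "l < dim_vec (e \<cdot>\<^sub>v w)"
      then have l: "l < n"
        using w by simp
      \<comment> \<open>Erasing column \<open>k\<close> only loses the term with
        \<open>w $ k = 0\<close>, and the erased row gives 0, which is
        \<open>e * w $ k\<close>.\<close>
      have "(\<Sum>m<n. (if l = k \<or> m = k then 0 else M $$ (l, m)) * w $ m)
          = (if l = k then 0 else \<Sum>m<n. M $$ (l, m) * w $ m)"
        using w(4) by (auto intro!: sum.cong)
      also have "\<dots> = (if l = k then 0 else (M *\<^sub>v w) $ l)"
        using M l w(1) by (auto simp: scalar_prod_def lessThan_atLeast0)
      also have "\<dots> = (e \<cdot>\<^sub>v w) $ l"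
        using w l by auto
      finally show "(mat_erase M k k *\<^sub>v w) $ l = (e \<cdot>\<^sub>v w) $ l"
        using M l w(1) by (simp add: mat_erase_def scalar_prod_def lessThan_atLeast0)
    qed (use M w in \<open>auto simp: mat_erase_def\<close>)
    moreover have er: "mat_erase M k k \<in> carrier_mat n n"
      using M by simp
    ultimately show ?thesis
      using w unfolding eigenvalue_root_char_poly[OF er, symmetric] eigenvalue_def eigenvector_def
      by auto
  qed
  then have "poly (monom 1 1 * pderiv ?p) e = 0"
    unfolding pderiv_char_poly_mat_erase[OF M] poly_sum by simp
  then have "poly (pderiv ?p) e = 0"
    using e by (simp add: poly_monom)
  then have "order e (pderiv ?p) \<noteq> 0"
    using \<open>pderiv ?p \<noteq> 0\<close> by (simp add: order_root)
  with order_pderiv[OF \<open>?p \<noteq> 0\<close> \<open>poly ?p e = 0\<close>] show ?thesis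
    by simp
qed

section \<open>Weighted graphs with a double null vector\<close>

text \<open>
  The minimal nonnegative solution, as the increasing limit of the fixed-point iteration from 0.
\<close>
lemma nonneg_solution_exists:
  fixes a :: "'v \<Rightarrow> 'v \<Rightarrow> real" and s :: "'v \<Rightarrow> real"
  assumes D: "D > 0" and a: "\<And>v u. 0 \<le> a v u" and s: "\<And>v. 0 \<le> s v"
    and dom: "\<And>v. v \<in> T \<Longrightarrow> s v + (\<Sum>u\<in>T. a v u) \<le> D"
  obtains \<phi> where "\<And>v. 0 \<le> \<phi> v" "\<And>v. v \<in> T \<Longrightarrow> D * \<phi> v = s v + (\<Sum>u\<in>T. a v u * \<phi> u)"
proof -
  define F where "F = (\<lambda>\<phi> v. if v \<in> T then (s v + (\<Sum>u\<in>T. a v u * \<phi> u)) / D else 0)"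
  define x where "x = (\<lambda>k. (F ^^ k) (\<lambda>_. 0))"
  have x_Suc: "x (Suc k) = F (x k)" for k
    by (simp add: x_def)
  have F_mono: "F \<phi> v \<le> F \<psi> v" if "\<And>u. \<phi> u \<le> \<psi> u" for \<phi> \<psi> :: "'v \<Rightarrow> real" and v
    using D a that by (auto simp: F_def intro!: divide_right_mono sum_mono mult_left_mono)
  have x_mono: "x k v \<le> x (Suc k) v" for k v
  proof (induction k arbitrary: v)
    case 0
    then show ?case
      using D s by (simp add: x_def F_def)
  next
    case (Suc k)
    then show ?case
      unfolding x_Suc[of k] x_Suc[of "Suc k"] by (intro F_mono)
  qed
  \<comment> \<open>By \<open>dom\<close> the constant 1 is a supersolution, so monotonicity keeps
    every iterate below it.\<close>
  have "F (\<lambda>_. 1) v \<le> 1" for v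
    using D dom by (simp add: F_def)
  then have x_le: "x k v \<le> 1" for k v
  proof (induction k arbitrary: v)
    case (Suc k)
    then show ?case
      unfolding x_Suc by (meson F_mono order_trans)
  qed (simp add: x_def)
  define \<phi> where "\<phi> = (\<lambda>v. lim (\<lambda>k. x k v))"
  have x_incseq: "incseq (\<lambda>k. x k v)" for v
    using x_mono by (rule incseq_SucI)
  have lim: "(\<lambda>k. x k v) \<longlonglongrightarrow> \<phi> v" for v
  proof -
    obtain L where "(\<lambda>k. x k v) \<longlonglongrightarrow> L"
      by (rule incseq_convergent[OF x_incseq[of v], of 1]) (use x_le in auto)
    then show ?thesis
      by (simp add: \<phi>_def limI)
  qed
  show thesis
  proof
    show "0 \<le> \<phi> v" for v
    proof (rule LIMSEQ_le_const[OF lim[of v]])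
      have "x 0 v \<le> x k v" for k
        using incseqD[OF x_incseq[of v], of 0 k] by simp
      then show "\<exists>N. \<forall>k\<ge>N. 0 \<le> x k v"
        by (auto simp: x_def)
    qed
    show "D * \<phi> v = s v + (\<Sum>u\<in>T. a v u * \<phi> u)" if "v \<in> T" for v
    proof (rule LIMSEQ_unique)
      show "(\<lambda>k. D * x (Suc k) v) \<longlonglongrightarrow> D * \<phi> v"
        by (intro tendsto_intros LIMSEQ_Suc lim)
      have "(\<lambda>k. D * x (Suc k) v) = (\<lambda>k. s v + (\<Sum>u\<in>T. a v u * x k u))"
        using D that by (auto simp: x_Suc F_def)
      then show "(\<lambda>k. D * x (Suc k) v) \<longlonglongrightarrow> s v + (\<Sum>u\<in>T. a v u * \<phi> u)"
        by (simp only:) (intro tendsto_intros lim)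
    qed
  qed
qed

text \<open>
  Only the positivity of \<open>d\<close> is essential: \<open>d\<close> becomes the constant 1 after a diagonal scaling,
  which makes \<open>f\<close> and \<open>g\<close> eigenvectors for the eigenvalue 1.
\<close>
definition null_pair :: "'v set \<Rightarrow> ('v \<Rightarrow> 'v \<Rightarrow> bool) \<Rightarrow> ('v \<Rightarrow> 'v \<Rightarrow> real) \<Rightarrow> ('v \<Rightarrow> real) \<Rightarrow>
    ('v \<Rightarrow> real) \<Rightarrow> ('v \<Rightarrow> real) \<Rightarrow> bool" where
  "null_pair V E w d f g \<longleftrightarrow>
     (\<forall>u v. w u v = w v u) \<and> (\<forall>u\<in>V. \<forall>v\<in>V. w u v \<noteq> 0 \<longleftrightarrow> E u v) \<and> (\<forall>v\<in>V. d v > 0) \<and>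
     (\<forall>v\<in>V. (\<Sum>u\<in>V. w v u * f u) = d v * f v) \<and>
     (\<forall>v\<in>V. (\<Sum>u\<in>V. w v u * g u) = d v * g v) \<and>
     (\<exists>u\<in>V. \<exists>v\<in>V. f u * g v \<noteq> f v * g u)"

definition degenerate :: "'v set \<Rightarrow> ('v \<Rightarrow> 'v \<Rightarrow> bool) \<Rightarrow> bool" where
  "degenerate V E \<longleftrightarrow> (\<exists>w d f g. null_pair V E w d f g)"

lemma degenerateI:
  fixes w :: "'v \<Rightarrow> 'v \<Rightarrow> real"
  assumes "\<And>u v. w u v = w v u" "\<And>u v. u \<in> V \<Longrightarrow> v \<in> V \<Longrightarrow> w u v \<noteq> 0 \<longleftrightarrow> E u v"
    and "\<And>v. v \<in> V \<Longrightarrow> d v > 0"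
    and "\<And>v. v \<in> V \<Longrightarrow> (\<Sum>u\<in>V. w v u * f u) = d v * f v"
    and "\<And>v. v \<in> V \<Longrightarrow> (\<Sum>u\<in>V. w v u * g u) = d v * g v"
    and "u \<in> V" "v \<in> V" "f u * g v \<noteq> f v * g u"
  shows "degenerate V E"
  unfolding degenerate_def null_pair_def using assms by (intro exI[of _ w] exI[of _ d] exI[of _ f] exI[of _ g]) auto

section \<open>Sources of degeneracy: disconnection, three branches, an edge that is not a
  bridge\<close>

lemma sum_of_bool_pos:
  fixes V :: "'v set"
  assumes "finite V" "u \<in> V" "E u"
  shows "(\<Sum>u\<in>V. of_bool (E u)) > (0 :: real)"
  using assms by (intro sum_pos2[of _ u]) auto

text \<open>No edge crosses between \<open>C\<close> and its complement, so both indicators are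
  constant along edges and the sum over the neighbours is the degree times the value. The absence of
  isolated vertices makes the degrees positive.\<close>

lemma degenerate_if_disconnected:
  assumes V: "finite V" and E: "symp E"
    and nonisolated: "\<And>v. v \<in> V \<Longrightarrow> \<exists>u\<in>V. E v u"
    and C: "C \<subseteq> V" "\<And>u v. u \<in> C \<Longrightarrow> v \<in> V - C \<Longrightarrow> \<not> E u v"
    and pq: "p \<in> C" "q \<in> V - C"
  shows "degenerate V E"
proof (rule degenerateI)
  let ?w = "\<lambda>u v. of_bool (E u v) :: real"
  let ?d = "\<lambda>v. \<Sum>u\<in>V. ?w v u"
  have sym: "E u v \<longleftrightarrow> E v u" for u v
    using E by (auto dest: sympD)
  then show "?w u v = ?w v u" for u v
    by simp
  show "?w u v \<noteq> 0 \<longleftrightarrow> E u v" for u v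
    by simp
  show "?d v > 0" if "v \<in> V" for v
    using sum_of_bool_pos[OF V] nonisolated[OF that] by blast
  have cross: "(u \<in> C) = (v \<in> C)" if "E v u" "u \<in> V" "v \<in> V" for u v
    using that C(2) sym by blast
  show "(\<Sum>u\<in>V. ?w v u * of_bool (u \<in> C)) = ?d v * of_bool (v \<in> C)" if "v \<in> V" for v
    unfolding sum_distrib_right using cross that by (intro sum.cong) auto
  show "(\<Sum>u\<in>V. ?w v u * of_bool (u \<notin> C)) = ?d v * of_bool (v \<notin> C)" if "v \<in> V" for v
    unfolding sum_distrib_right using cross that by (intro sum.cong) auto
  show "p \<in> V" "q \<in> V"
    using C(1) pq by auto
  show "of_bool (p \<in> C) * of_bool (q \<notin> C) \<noteq> of_bool (q \<in> C) * (of_bool (p \<notin> C) :: real)"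
    using pq by simp
qed

text \<open>The indicator of branch \<open>i\<close> satisfies its equation everywhere except at
  \<open>v0\<close>, where it leaves the defect \<open>m i\<close>. The combinations
  \<open>m 0 * \<chi> i - m i * \<chi> 0\<close> for \<open>i = 1, 2\<close> cancel the defects, and
  \<open>attached\<close> makes \<open>m 0\<close> positive, hence the two independent.\<close>

lemma degenerate_if_three_branches:
  assumes V: "finite V" and E: "symp E" and v0: "v0 \<in> V"
    and C: "\<And>i. i < 3 \<Longrightarrow> C i \<subseteq> V - {v0}"
    and disj: "\<And>i j. i < 3 \<Longrightarrow> j < 3 \<Longrightarrow> i \<noteq> j \<Longrightarrow> C i \<inter> C j = {}"
    and closed: "\<And>i u v. i < 3 \<Longrightarrow> u \<in> C i \<Longrightarrow> v \<in> V - {v0} - C i \<Longrightarrow> \<not> E u v"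
    and nonisolated: "\<And>i u. i < 3 \<Longrightarrow> u \<in> C i \<Longrightarrow> \<exists>v\<in>V - {v0}. E u v"
    and nonempty: "\<And>i. i < 3 \<Longrightarrow> C i \<noteq> {}"
    and attached: "a \<in> C (0 :: nat)" "E v0 a"
  shows "degenerate V E"
proof -
  let ?V = "V - {v0}"
  let ?w = "\<lambda>u v. of_bool (E u v) :: real"
  define \<chi> where "\<chi> = (\<lambda>i u. of_bool (u \<in> C i) :: real)"
  define m where "m = (\<lambda>i. \<Sum>u\<in>V. ?w v0 u * \<chi> i u)"
  \<comment> \<open>Edges to \<open>v0\<close> do not count, since all indicators vanish there. The
    default 1 keeps \<open>d\<close> positive at a vertex without neighbours in \<open>?V\<close>;
    by \<open>nonisolated\<close> such a vertex lies in no branch, so its equation still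
    holds.\<close>
  define d where "d = (\<lambda>v. if \<exists>u\<in>?V. E v u then \<Sum>u\<in>?V. ?w v u else 1)"
  have sym: "E u v \<longleftrightarrow> E v u" for u v
    using E by (auto dest: sympD)
  have d_pos: "d v > 0" for v
    using V by (auto simp: d_def intro: sum_of_bool_pos)
  have \<chi>_v0: "\<chi> i v0 = 0" if "i < 3" for i
    using C[OF that] by (auto simp: \<chi>_def)
  have \<chi>_eq: "(\<Sum>u\<in>V. ?w v u * \<chi> i u) = d v * \<chi> i v" if "i < 3" "v \<in> ?V" for i v
  proof -
    have "(\<Sum>u\<in>V. ?w v u * \<chi> i u) = (\<Sum>u\<in>?V. ?w v u * \<chi> i u)"
      using V v0 \<chi>_v0[OF that(1)] by (subst sum.remove[of _ v0]) auto
    also have "\<dots> = (\<Sum>u\<in>?V. ?w v u * \<chi> i v)"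
    proof (rule sum.cong[OF refl])
      fix u
      assume "u \<in> ?V"
      then have "u \<in> C i \<longleftrightarrow> v \<in> C i" if "E v u"
        using that closed[OF \<open>i < 3\<close>] \<open>v \<in> ?V\<close> sym by blast
      then show "?w v u * \<chi> i u = ?w v u * \<chi> i v"
        by (auto simp: \<chi>_def)
    qed
    also have "\<dots> = d v * \<chi> i v"
      using nonisolated[OF that(1), of v] by (auto simp: d_def \<chi>_def sum_distrib_right)
    finally show ?thesis .
  qed
  have comb: "(\<Sum>u\<in>V. ?w v u * (m 0 * \<chi> i u - m i * \<chi> 0 u)) = d v * (m 0 * \<chi> i v - m i * \<chi> 0 v)"
    if "i < 3" "v \<in> V" for i v
  proof -
    have "(\<Sum>u\<in>V. ?w v u * (m 0 * \<chi> i u - m i * \<chi> 0 u))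
        = m 0 * (\<Sum>u\<in>V. ?w v u * \<chi> i u) - m i * (\<Sum>u\<in>V. ?w v u * \<chi> 0 u)"
      by (simp add: sum_subtractf sum_distrib_left right_diff_distrib mult.left_commute)
    also have "\<dots> = d v * (m 0 * \<chi> i v - m i * \<chi> 0 v)"
    proof (cases "v = v0")
      case True
      then show ?thesis using that by (simp add: m_def \<chi>_v0 mult.commute)
    next
      case False
      then have v: "v \<in> ?V"
        using that by simp
      show ?thesis
        unfolding \<chi>_eq[OF that(1) v] \<chi>_eq[of 0, OF _ v, simplified] by (simp add: algebra_simps)
    qed
    finally show ?thesis .
  qed
  have "m 0 > 0"
    unfolding m_def using V attached C[of 0] by (intro sum_pos2[of _ a]) (auto simp: \<chi>_def)
  obtain b c where b: "b \<in> C 1" and c: "c \<in> C 2"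
    using nonempty[of 1] nonempty[of 2] by auto
  have notin: "b \<notin> C 0" "b \<notin> C 2" "c \<notin> C 0" "c \<notin> C 1"
    using b c disj[of 0 1] disj[of 1 2] disj[of 0 2] by auto
  show ?thesis
  proof (rule degenerateI[of ?w])
    show "?w u v = ?w v u" for u v
      using sym by simp
    show "(\<Sum>u\<in>V. ?w v u * (m 0 * \<chi> 1 u - m 1 * \<chi> 0 u)) = d v * (m 0 * \<chi> 1 v - m 1 * \<chi> 0 v)"
      if "v \<in> V" for v
      using comb that by simp
    show "(\<Sum>u\<in>V. ?w v u * (m 0 * \<chi> 2 u - m 2 * \<chi> 0 u)) = d v * (m 0 * \<chi> 2 v - m 2 * \<chi> 0 v)"
      if "v \<in> V" for v
      using comb that by simp
    show "b \<in> V" "c \<in> V"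
      using b c C[of 1] C[of 2] by auto
    \<comment> \<open>The minor at \<open>b\<close>, \<open>c\<close> is diagonal with both diagonal
      entries \<open>m 0\<close>.\<close>
    show "(m 0 * \<chi> 1 b - m 1 * \<chi> 0 b) * (m 0 * \<chi> 2 c - m 2 * \<chi> 0 c)
        \<noteq> (m 0 * \<chi> 1 c - m 1 * \<chi> 0 c) * (m 0 * \<chi> 2 b - m 2 * \<chi> 0 b)"
      using b c notin \<open>m 0 > 0\<close> by (simp add: \<chi>_def)
  qed (use d_pos in auto)
qed

text \<open>
  The diagonal value \<open>card V\<close> off \<open>{p, q}\<close> dominates every degree, which keeps the iteration for the
  two Dirichlet problems bounded.
\<close>
lemma degenerate_if_not_bridge:
  assumes V: "finite V" and E: "symp E" and irrefl: "\<And>v. \<not> E v v"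
    and pq: "p \<in> V" "q \<in> V" "E p q"
    and p_nbr: "\<exists>u\<in>V - {p, q}. E p u" and q_nbr: "\<exists>u\<in>V - {p, q}. E q u"
    and not_bridge: "\<And>C. C \<subseteq> V \<Longrightarrow> p \<in> C \<Longrightarrow> q \<notin> C \<Longrightarrow>
      \<exists>u\<in>C. \<exists>v\<in>V - C. E u v \<and> (u \<noteq> p \<or> v \<noteq> q)"
  shows "degenerate V E"
proof -
  let ?T = "V - {p, q}"
  let ?e = "\<lambda>u v. of_bool (E u v) :: real"
  define D where "D = real (card V)"
  have sym: "E u v \<longleftrightarrow> E v u" for u v
    using E by (auto dest: sympD)
  have "p \<noteq> q"
    using pq irrefl by auto
  have D: "D > 0"
    using V pq by (auto simp: D_def card_gt_0_iff)
  have split: "(\<Sum>u\<in>V. h u) = h p + h q + (\<Sum>u\<in>?T. h u)" for h :: "'a \<Rightarrow> real"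
    using V pq \<open>p \<noteq> q\<close> by (simp add: sum.remove[of V p] sum.remove[of "V - {p}" q] Diff_insert2[symmetric] insert_commute)
  have dom: "?e v r + (\<Sum>u\<in>?T. ?e v u) \<le> D" if "r = p \<or> r = q" for v r
  proof -
    have "?e v r + (\<Sum>u\<in>?T. ?e v u) \<le> (\<Sum>u\<in>V. ?e v u)"
      using that by (auto simp: split[of "?e v"])
    also have "\<dots> \<le> (\<Sum>u\<in>V. 1)"
      by (intro sum_mono) auto
    finally show ?thesis by (simp add: D_def)
  qed
  obtain \<phi> where \<phi>: "\<And>v. 0 \<le> \<phi> v" "\<And>v. v \<in> ?T \<Longrightarrow> D * \<phi> v = ?e v p + (\<Sum>u\<in>?T. ?e v u * \<phi> u)"
    by (rule nonneg_solution_exists[of D ?e "\<lambda>v. ?e v p" ?T]) (use D dom in auto)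
  obtain \<psi> where \<psi>: "\<And>v. 0 \<le> \<psi> v" "\<And>v. v \<in> ?T \<Longrightarrow> D * \<psi> v = ?e v q + (\<Sum>u\<in>?T. ?e v u * \<psi> u)"
    by (rule nonneg_solution_exists[of D ?e "\<lambda>v. ?e v q" ?T]) (use D dom in auto)
  \<comment> \<open>A neighbour of \<open>r\<close> in \<open>?T\<close> receives the source term 1,
    so the solution is positive there. This will make \<open>d\<close> positive at \<open>p\<close>
    and \<open>q\<close>.\<close>
  have nbr_pos: "(\<Sum>u\<in>?T. ?e r u * \<theta> u) > 0"
    if \<theta>: "\<And>v. 0 \<le> \<theta> v" "\<And>v. v \<in> ?T \<Longrightarrow> D * \<theta> v = ?e v r + (\<Sum>u\<in>?T. ?e v u * \<theta> u)"
      and u: "u \<in> ?T" "E r u" for \<theta> r u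
  proof -
    have "0 \<le> (\<Sum>v\<in>?T. ?e u v * \<theta> v)"
      using \<theta>(1) by (intro sum_nonneg) auto
    then have "D * \<theta> u > 0"
      using \<theta>(2)[OF u(1)] u sym by simp
    then have "\<theta> u > 0"
      using D by (simp add: zero_less_mult_iff)
    then show ?thesis
      using V u \<theta>(1) by (intro sum_pos2[of _ u]) auto
  qed
  define c where "c = (\<Sum>u\<in>?T. ?e q u * \<phi> u)"
  \<comment> \<open>Green's identity: each Dirichlet equation is tested against the other solution,
    and the interior terms agree by symmetry.\<close>
  have c_sym: "c = (\<Sum>u\<in>?T. ?e p u * \<psi> u)"
  proof -
    let ?S = "\<Sum>v\<in>?T. \<Sum>u\<in>?T. ?e v u * \<phi> u * \<psi> v"
    have "(\<Sum>v\<in>?T. D * \<phi> v * \<psi> v) = (\<Sum>v\<in>?T. ?e p v * \<psi> v) + ?S"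
      using sym by (simp add: \<phi>(2) distrib_right sum.distrib sum_distrib_right del: Diff_iff)
    moreover have "(\<Sum>v\<in>?T. D * \<psi> v * \<phi> v) = c + (\<Sum>v\<in>?T. \<Sum>u\<in>?T. ?e v u * \<psi> u * \<phi> v)"
      using sym by (simp add: \<psi>(2) c_def distrib_right sum.distrib sum_distrib_right del: Diff_iff)
    moreover have "(\<Sum>v\<in>?T. \<Sum>u\<in>?T. ?e v u * \<psi> u * \<phi> v) = ?S"
      using sym by (subst sum.swap) (simp add: mult_ac)
    ultimately show ?thesis
      by (simp add: mult_ac)
  qed
  have "c \<noteq> 0"
  proof
    assume "c = 0"
    then have q_zero: "\<phi> u = 0" if "u \<in> ?T" "E q u" for u
      using V \<phi>(1) that unfolding c_def by (subst (asm) sum_nonneg_eq_0_iff) auto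
    \<comment> \<open>If no flow reached \<open>q\<close>, then \<open>p\<close> together with the
      support of \<open>\<phi>\<close> would be a cut crossed by \<open>pq\<close> alone:
      \<open>\<phi>\<close> vanishes at the neighbours of \<open>q\<close> in \<open>?T\<close>, and
      a zero of \<open>\<phi>\<close> in \<open>?T\<close> has no neighbour in the cut.\<close>
    let ?C = "insert p {v\<in>?T. \<phi> v \<noteq> 0}"
    have "\<exists>u\<in>?C. \<exists>v\<in>V - ?C. E u v \<and> (u \<noteq> p \<or> v \<noteq> q)"
      using pq \<open>p \<noteq> q\<close> by (intro not_bridge) auto
    then obtain u v where uv: "u \<in> ?C" "v \<in> V - ?C" "E u v" "u \<noteq> p \<or> v \<noteq> q"
      by blast
    show False
    proof (cases "v = q")
      case True
      then show ?thesis using uv q_zero sym by auto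
    next
      case False
      then have v: "v \<in> ?T" "\<phi> v = 0"
        using uv by auto
      have "(\<Sum>x\<in>?T. ?e v x * \<phi> x) \<ge> 0"
        using \<phi>(1) by (intro sum_nonneg) auto
      then have "?e v p = 0" "(\<Sum>x\<in>?T. ?e v x * \<phi> x) = 0"
        using \<phi>(2)[OF v(1)] v(2) by (auto simp: of_bool_def split: if_splits)
      moreover from this(2) have "?e v x * \<phi> x = 0" if "x \<in> ?T" for x
        using V \<phi>(1) that by (subst (asm) sum_nonneg_eq_0_iff) auto
      ultimately show ?thesis
        using uv sym by auto
    qed
  qed
  define w where "w = (\<lambda>u v. if (u, v) = (p, q) \<or> (u, v) = (q, p) then - c else ?e u v)"
  \<comment> \<open>The values at \<open>p\<close> and \<open>q\<close> are forced by the equation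
    of \<open>f\<close> at \<open>p\<close> and that of \<open>g\<close> at \<open>q\<close>. In the
    other two boundary equations the weight \<open>- c\<close> cancels the inflow, which is
    \<open>c\<close> both times by \<open>c_sym\<close>.\<close>
  define d where "d = (\<lambda>v. if v = p then \<Sum>u\<in>?T. ?e p u * \<phi> u
    else if v = q then \<Sum>u\<in>?T. ?e q u * \<psi> u else D)"
  define f where "f = (\<lambda>v. if v = p then 1 else if v = q then 0 else \<phi> v)"
  define g where "g = (\<lambda>v. if v = p then 0 else if v = q then 1 else \<psi> v)"
  have f_T: "(\<Sum>u\<in>?T. w v u * f u) = (\<Sum>u\<in>?T. ?e v u * \<phi> u)" for v
    by (intro sum.cong) (auto simp: w_def f_def)
  have g_T: "(\<Sum>u\<in>?T. w v u * g u) = (\<Sum>u\<in>?T. ?e v u * \<psi> u)" for v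
    by (intro sum.cong) (auto simp: w_def g_def)
  show ?thesis
  proof (rule degenerateI[of w])
    show "w u v = w v u" for u v
      using sym by (auto simp: w_def)
    show "w u v \<noteq> 0 \<longleftrightarrow> E u v" for u v
      using \<open>c \<noteq> 0\<close> pq sym by (auto simp: w_def)
    show "d v > 0" for v
      using D p_nbr q_nbr nbr_pos[OF \<phi>] nbr_pos[OF \<psi>] unfolding d_def by auto
    show "(\<Sum>u\<in>V. w v u * f u) = d v * f v" if "v \<in> V" for v
      unfolding split f_T using that \<open>p \<noteq> q\<close> irrefl \<phi>(2)[of v]
      by (auto simp: w_def d_def f_def c_def)
    show "(\<Sum>u\<in>V. w v u * g u) = d v * g v" if "v \<in> V" for v
      unfolding split g_T using that \<open>p \<noteq> q\<close> irrefl \<psi>(2)[of v]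
      by (auto simp: w_def d_def g_def c_sym)
    show "f p * g q \<noteq> f q * g p"
      using \<open>p \<noteq> q\<close> by (simp add: f_def g_def)
  qed (use pq in auto)
qed

text \<open>
  The maps \<open>s\<close> and \<open>t\<close> stand for rows and columns in either order. Two of the branches at \<open>v\<close> hang on
  \<open>s v\<close>; the rest of the graph, together with \<open>t v\<close> unless that became isolated, is the third branch
  at \<open>s v\<close>.
\<close>
lemma degenerate_if_claw:
  fixes R adj :: "'a \<Rightarrow> 'a \<Rightarrow> bool" and E :: "'b \<Rightarrow> 'b \<Rightarrow> bool" and s t :: "'a \<Rightarrow> 'b"
  assumes adj_def: "\<And>i j. adj i j \<longleftrightarrow> i \<noteq> j \<and> (R i j \<or> R j i)"
    and V: "finite V" and E: "symp E"
    and inj: "inj s" "inj t" "\<And>i j. s i \<noteq> t j"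
    and E_st: "\<And>i j. i \<in> V \<Longrightarrow> j \<in> V \<Longrightarrow> E (s i) (t j) \<longleftrightarrow> R i j"
    and E_ss: "\<And>i j. \<not> E (s i) (s j)" and E_tt: "\<And>i j. \<not> E (t i) (t j)"
    and refl: "\<And>i. i \<in> V \<Longrightarrow> R i i"
    and antisym: "\<And>i j. i \<in> V \<Longrightarrow> j \<in> V \<Longrightarrow> R i j \<Longrightarrow> R j i \<Longrightarrow> i = j"
    and conn: "\<And>C. C \<subseteq> V \<Longrightarrow> C \<noteq> {} \<Longrightarrow> C \<noteq> V \<Longrightarrow> \<exists>u\<in>C. \<exists>v\<in>V - C. adj u v"
    and bridge: "\<And>u v. u \<in> V \<Longrightarrow> v \<in> V \<Longrightarrow> adj u v \<Longrightarrow>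
      \<exists>C\<subseteq>V. u \<in> C \<and> v \<notin> C \<and> (\<forall>x\<in>C. \<forall>y\<in>V - C. adj x y \<longrightarrow> x = u \<and> y = v)"
    and mem: "v \<in> V" "a \<in> V" "b \<in> V" "c \<in> V" and distinct: "distinct [v, a, b, c]"
    and nbrs: "R v a" "R v b" "adj v c"
  shows "degenerate (s ` V \<union> t ` V) E"
proof -
  let ?W = "s ` V \<union> t ` V"
  let ?L = "\<lambda>C. s ` C \<union> t ` C"
  have inj' [simp]: "s i = s j \<longleftrightarrow> i = j" "t i = t j \<longleftrightarrow> i = j" "s i \<noteq> t j" "t j \<noteq> s i" for i j
    using inj inj(3)[of i j, symmetric] by (auto dest: injD)
  have sym: "E u v \<longleftrightarrow> E v u" for u v
    using E by (auto dest: sympD)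
  have E_ts: "E (t j) (s i) \<longleftrightarrow> R i j" if "i \<in> V" "j \<in> V" for i j
    using E_st[OF that] sym by blast
  have adj_sym: "adj i j \<longleftrightarrow> adj j i" for i j
    by (auto simp: adj_def)
  have branch: "\<exists>C\<subseteq>V. x \<in> C \<and> v \<notin> C \<and> (\<forall>i\<in>C. \<forall>j\<in>V - C. adj i j \<longrightarrow> i = x \<and> j = v)"
    if "x \<in> {a, b}" for x
    using that mem distinct nbrs bridge[of x v] by (auto simp: adj_def)
  obtain A where A: "A \<subseteq> V" "a \<in> A" "v \<notin> A"
      and A_cross: "\<And>i j. i \<in> A \<Longrightarrow> j \<in> V - A \<Longrightarrow> adj i j \<Longrightarrow> i = a \<and> j = v"
    using branch[of a] by auto
  obtain B where B: "B \<subseteq> V" "b \<in> B" "v \<notin> B"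
      and B_cross: "\<And>i j. i \<in> B \<Longrightarrow> j \<in> V - B \<Longrightarrow> adj i j \<Longrightarrow> i = b \<and> j = v"
    using branch[of b] by auto
  have adj_v: "adj a v" "adj b v" "adj c v"
    using nbrs distinct by (auto simp: adj_def)
  have "a \<notin> B" "b \<notin> A" "c \<notin> A" "c \<notin> B"
    using A_cross[of b v] A_cross[of c v] B_cross[of a v] B_cross[of c v] adj_v A(3) B(3) mem distinct
    by auto
  \<comment> \<open>An edge leaving the intersection leaves \<open>A\<close> or \<open>B\<close>, so
    it starts at \<open>a\<close> or \<open>b\<close>, and neither lies in both sets. By
    connectedness the intersection is empty.\<close>
  have AB: "A \<inter> B = {}"
  proof (rule ccontr)
    assume "A \<inter> B \<noteq> {}"
    then obtain i j where ij: "i \<in> A \<inter> B" "j \<in> V - A \<inter> B" "adj i j"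
      using conn[of "A \<inter> B"] A mem by auto
    then have "i = a \<or> i = b"
      using A_cross[of i j] B_cross[of i j] by auto
    with ij \<open>a \<notin> B\<close> \<open>b \<notin> A\<close> show False by auto
  qed
  define C where "C = V - insert v (A \<union> B)"
  \<comment> \<open>\<open>t v\<close> joins only if it has a neighbour other than
    \<open>s v\<close>; otherwise the removal of \<open>s v\<close> would isolate it within the
    branch.\<close>
  define C' where "C' = ?L C \<union> (if \<exists>k\<in>V - {v}. R k v then {t v} else {})"
  \<comment> \<open>The only adjacency leaving \<open>X\<close> is that of \<open>x\<close> and
    \<open>v\<close>, and by antisymmetry its arc goes from \<open>v\<close> to \<open>x\<close>.
    The corresponding edge joins \<open>s v\<close> to \<open>t x\<close>, so none is left once
    \<open>s v\<close> is removed.\<close>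
  have L_closed: "\<not> E u w" if X: "X \<subseteq> V" and x: "R v x" "x \<noteq> v" "x \<in> X" "v \<notin> X"
      and cross: "\<And>i j. i \<in> X \<Longrightarrow> j \<in> V - X \<Longrightarrow> adj i j \<Longrightarrow> i = x \<and> j = v"
      and uw: "u \<in> ?L X" "w \<in> ?W - {s v} - ?L X" for X x u w
  proof
    assume "E u w"
    from uw(1) show False
    proof
      assume "u \<in> s ` X"
      then obtain i where "u = s i" "i \<in> X"
        by auto
      moreover from this obtain j where "w = t j" "j \<in> V - X"
        using uw(2) \<open>E u w\<close> E_ss by blast
      ultimately have "u = s i" "i \<in> X" "w = t j" "j \<in> V - X"
        by auto
      then have "R i j" "i \<noteq> j"
        using E_st[of i j] \<open>E u w\<close> X by auto
      then have "i = x" "j = v"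
        using cross[of i j] \<open>i \<in> X\<close> \<open>j \<in> V - X\<close> by (auto simp: adj_def)
      then show False
        using antisym[of v x] x X mem \<open>R i j\<close> by auto
    next
      assume "u \<in> t ` X"
      then obtain i where "u = t i" "i \<in> X"
        by auto
      moreover from this obtain j where "w = s j" "j \<in> V - X" "j \<noteq> v"
        using uw(2) \<open>E u w\<close> E_tt by blast
      ultimately have "u = t i" "i \<in> X" "w = s j" "j \<in> V - X" "j \<noteq> v"
        by auto
      then have "R j i" "i \<noteq> j"
        using E_ts[of j i] \<open>E u w\<close> X by auto
      then show False
        using cross[of i j] \<open>i \<in> X\<close> \<open>j \<in> V - X\<close> \<open>j \<noteq> v\<close> by (auto simp: adj_def)
    qed
  qed
  have C_nbr: "j \<in> C \<or> j = v" if "i \<in> C" "j \<in> V" "adj i j" for i j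
    using that A_cross[of j i] B_cross[of j i] adj_sym unfolding C_def by blast
  have C'_closed: "\<not> E u w" if u: "u \<in> C'" and w: "w \<in> ?W - {s v} - C'" for u w
  proof
    assume "E u w"
    from u consider i where "u = s i" "i \<in> C" | i where "u = t i" "i \<in> C"
      | k where "u = t v" "k \<in> V - {v}" "R k v"
      unfolding C'_def by (auto split: if_splits)
    then show False
    proof cases
      case (1 i)
      then obtain j where j: "w = t j" "j \<in> V - C"
        using w \<open>E u w\<close> E_ss unfolding C'_def by blast
      moreover have "R i j"
        using 1 j \<open>E u w\<close> E_st by (auto simp: C_def)
      ultimately have "j = v"
        using C_nbr[of i j] 1 by (auto simp: adj_def)
      then have "t v \<in> C'"
        using 1 \<open>R i j\<close> unfolding C'_def C_def by auto
      with w j \<open>j = v\<close> show False by auto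
    next
      case (2 i)
      then obtain j where j: "w = s j" "j \<in> V - C" "j \<noteq> v"
        using w \<open>E u w\<close> E_tt unfolding C'_def by blast
      moreover have "R j i"
        using 2 j \<open>E u w\<close> E_ts by (auto simp: C_def)
      ultimately show False
        using C_nbr[of i j] 2 by (auto simp: adj_def)
    next
      \<comment> \<open>A neighbour \<open>s j\<close> of \<open>t v\<close> with \<open>j\<close>
        in \<open>A\<close> or \<open>B\<close> would have \<open>j = a\<close> or
        \<open>j = b\<close>, giving arcs in both directions between \<open>v\<close> and
        \<open>j\<close>.\<close>
      case 3
      then obtain j where j: "w = s j" "j \<in> V - C" "j \<noteq> v"
        using w \<open>E u w\<close> E_tt unfolding C'_def by blast
      then have "R j v"
        using 3 mem \<open>E u w\<close> E_ts by auto
      moreover from this have "j = a \<or> j = b"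
        using j A_cross[of j v] B_cross[of j v] A B mem by (auto simp: C_def adj_def)
      ultimately show False
        using nbrs antisym mem distinct by auto
    qed
  qed
  define F where "F = (\<lambda>i :: nat. if i = 0 then ?L A else if i = 1 then ?L B else C')"
  have less_3: "i = 0 \<or> i = 1 \<or> i = 2" if "i < 3" for i :: nat
    using that by auto
  have L_sub: "?L X \<subseteq> ?W - {s v}" if "X \<subseteq> V" "v \<notin> X" for X
    using that by auto
  have C'_sub: "C' \<subseteq> ?W - {s v}"
    using L_sub[of C] mem unfolding C'_def by (auto simp: C_def)
  have L_disj: "?L X \<inter> ?L Y = {}" if "X \<inter> Y = {}" for X Y
    using that by auto
  have L_disj': "?L X \<inter> C' = {}" if "X = A \<or> X = B" for X
    using that L_disj[of X C] A B unfolding C'_def by (auto simp: C_def)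
  have L_nonisolated: "\<exists>w\<in>?W - {s v}. E u w" if "X \<subseteq> V" "v \<notin> X" "u \<in> ?L X" for X u
  proof -
    obtain x where x: "x \<in> X" "u = s x \<or> u = t x"
      using \<open>u \<in> ?L X\<close> by auto
    then have "x \<in> V" "x \<noteq> v"
      using that by auto
    then show ?thesis
      using x E_st[of x x] E_ts[of x x] refl[of x] by (auto intro: bexI[of _ "t x"] bexI[of _ "s x"])
  qed
  show ?thesis
  proof (rule degenerate_if_three_branches[of ?W E "s v" F "t a"])
    show "F i \<subseteq> ?W - {s v}" if "i < 3" for i
      using less_3[OF that] L_sub[OF A(1,3)] L_sub[OF B(1,3)] C'_sub by (auto simp: F_def)
    show "F i \<inter> F j = {}" if "i < 3" "j < 3" "i \<noteq> j" for i j
      using less_3[OF that(1)] less_3[OF that(2)] \<open>i \<noteq> j\<close> L_disj[OF AB] L_disj'[of A] L_disj'[of B]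
      by (auto simp: F_def)
    show "\<not> E u w" if "i < 3" "u \<in> F i" "w \<in> ?W - {s v} - F i" for i u w
      using less_3[OF that(1)]
    proof (elim disjE)
      assume "i = 0"
      then show ?thesis
        using that A distinct L_closed[OF A(1) nbrs(1) _ A(2,3) A_cross] by (auto simp: F_def)
    next
      assume "i = 1"
      then show ?thesis
        using that B distinct L_closed[OF B(1) nbrs(2) _ B(2,3) B_cross] by (auto simp: F_def)
    next
      assume "i = 2"
      then show ?thesis
        using that C'_closed by (simp add: F_def)
    qed
    show "\<exists>w\<in>?W - {s v}. E u w" if "i < 3" "u \<in> F i" for i u
      using less_3[OF that(1)]
    proof (elim disjE)
      assume "i = 2"
      with that have "u \<in> ?L C \<or> (\<exists>k\<in>V - {v}. u = t v \<and> R k v)"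
        by (auto simp: F_def C'_def split: if_splits)
      then show ?thesis
      proof
        assume "u \<in> ?L C"
        then show ?thesis
          by (intro L_nonisolated[of C]) (auto simp: C_def)
      next
        assume "\<exists>k\<in>V - {v}. u = t v \<and> R k v"
        then obtain k where "k \<in> V - {v}" "u = t v" "R k v"
          by auto
        then show ?thesis
          using E_ts[of k v] mem by (intro bexI[of _ "s k"]) auto
      qed
    qed (use that L_nonisolated[OF A(1,3)] L_nonisolated[OF B(1,3)] in \<open>auto simp: F_def\<close>)
    have "c \<in> C"
      using mem distinct \<open>c \<notin> A\<close> \<open>c \<notin> B\<close> by (auto simp: C_def)
    then show "F i \<noteq> {}" for i
      using A B by (auto simp: F_def C'_def)
    show "t a \<in> F 0" "E (s v) (t a)"
      using A E_st mem nbrs by (auto simp: F_def)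
  qed (use V E mem in auto)
qed

section \<open>Singular values\<close>

fun bipartite_adj :: "nat mat \<Rightarrow> nat + nat \<Rightarrow> nat + nat \<Rightarrow> bool" where
  "bipartite_adj P (Inl i) (Inr j) \<longleftrightarrow> P $$ (i, j) = 1"
| "bipartite_adj P (Inr j) (Inl i) \<longleftrightarrow> P $$ (i, j) = 1"
| "bipartite_adj P _ _ \<longleftrightarrow> False"

lemma symp_bipartite_adj: "symp (bipartite_adj P)"
proof
  show "bipartite_adj P v u" if "bipartite_adj P u v" for u v
    using that by (cases u; cases v) auto
qed

text \<open>Dividing each weight by the square roots of \<open>d\<close> at its two ends gives
  \<open>A\<close>. A solution \<open>h\<close>, multiplied by the square root of \<open>d\<close>,
  splits into a row part \<open>X h\<close> and a column part \<open>Y h\<close> that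
  \<open>A\<close> and its transpose exchange. Hence \<open>X f\<close> and \<open>X g\<close> are
  eigenvectors of \<open>A * transpose_mat A\<close> for 1.\<close>

lemma repeated_singular_value_if_degenerate:
  assumes P: "P \<in> carrier_mat n n" and "degenerate ({..<n} <+> {..<n}) (bipartite_adj P)"
  obtains A where "has_pattern A P" "2 \<le> count (singular_values A) 1"
proof -
  let ?V = "{..<n} <+> {..<n}"
  have mem [simp]: "Inl i \<in> ?V \<longleftrightarrow> i < n" "Inr i \<in> ?V \<longleftrightarrow> i < n" for i :: nat
    by auto
  obtain w d f g where null: "null_pair ?V (bipartite_adj P) w d f g"
    using assms(2) unfolding degenerate_def by blast
  have w_sym: "w u v = w v u" for u v
    using null unfolding null_pair_def by blast
  have w_supp: "w u v \<noteq> 0 \<longleftrightarrow> bipartite_adj P u v" if "u \<in> ?V" "v \<in> ?V" for u v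
    using null that unfolding null_pair_def by blast
  have d_pos: "d v > 0" if "v \<in> ?V" for v
    using null that unfolding null_pair_def by blast
  have f_null: "(\<Sum>u\<in>?V. w v u * f u) = d v * f v" if "v \<in> ?V" for v
    using null that unfolding null_pair_def by blast
  have g_null: "(\<Sum>u\<in>?V. w v u * g u) = d v * g v" if "v \<in> ?V" for v
    using null that unfolding null_pair_def by blast
  have indep: "\<exists>u\<in>?V. \<exists>v\<in>?V. f u * g v \<noteq> f v * g u"
    using null unfolding null_pair_def by blast
  define W where "W = (\<lambda>i j. w (Inl i) (Inr j))"
  define r where "r = (\<lambda>i. sqrt (d (Inl i)))"
  define c where "c = (\<lambda>j. sqrt (d (Inr j)))"
  have r: "r i > 0" "d (Inl i) = r i * r i" and c: "c i > 0" "d (Inr i) = c i * c i" if "i < n" for i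
    using d_pos[of "Inl i"] d_pos[of "Inr i"] that by (simp_all add: r_def c_def)
  have nonzero [simp]: "r i \<noteq> 0" "c i \<noteq> 0" if "i < n" for i
    using r(1)[OF that] c(1)[OF that] by auto
  \<comment> \<open>Weights between two rows are 0, so only the columns contribute;
    \<open>col\<close> is the same with the sides exchanged.\<close>
  have row: "(\<Sum>j<n. W i j * h (Inr j)) = d (Inl i) * h (Inl i)"
    if "\<And>v. v \<in> ?V \<Longrightarrow> (\<Sum>u\<in>?V. w v u * h u) = d v * h v" "i < n" for h i
  proof -
    have "w (Inl i) (Inl k) = 0" if "k < n" for k
      using w_supp[of "Inl i" "Inl k"] that \<open>i < n\<close> by auto
    then show ?thesis
      using that(1)[of "Inl i"] \<open>i < n\<close> by (simp add: sum.Plus W_def)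
  qed
  have col: "(\<Sum>i<n. W i j * h (Inl i)) = d (Inr j) * h (Inr j)"
    if "\<And>v. v \<in> ?V \<Longrightarrow> (\<Sum>u\<in>?V. w v u * h u) = d v * h v" "j < n" for h j
  proof -
    have "w (Inr j) (Inr k) = 0" if "k < n" for k
      using w_supp[of "Inr j" "Inr k"] that \<open>j < n\<close> by auto
    then show ?thesis
      using that(1)[of "Inr j"] \<open>j < n\<close> by (simp add: sum.Plus W_def w_sym[of "Inr j"])
  qed
  define A where "A = mat n n (\<lambda>(i, j). W i j / (r i * c j))"
  have A: "A \<in> carrier_mat n n"
    by (simp add: A_def)
  define X where "X = (\<lambda>h :: nat + nat \<Rightarrow> real. vec n (\<lambda>i. r i * h (Inl i)))"
  define Y where "Y = (\<lambda>h :: nat + nat \<Rightarrow> real. vec n (\<lambda>j. c j * h (Inr j)))"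
  have X: "X h \<in> carrier_vec n" for h
    by (simp add: X_def)
  have eigen: "(A * transpose_mat A) *\<^sub>v X h = 1 \<cdot>\<^sub>v X h"
    if h: "\<And>v. v \<in> ?V \<Longrightarrow> (\<Sum>u\<in>?V. w v u * h u) = d v * h v" for h
  proof -
    have "transpose_mat A *\<^sub>v X h = Y h"
    proof (rule eq_vecI)
      fix j
      assume "j < dim_vec (Y h)"
      then have j: "j < n"
        by (simp add: Y_def)
      have "(transpose_mat A *\<^sub>v X h) $ j = (\<Sum>i<n. W i j / (r i * c j) * (r i * h (Inl i)))"
        using j by (simp add: A_def X_def scalar_prod_def lessThan_atLeast0)
      also have "\<dots> = (\<Sum>i<n. W i j * h (Inl i)) / c j"
        unfolding sum_divide_distrib by (intro sum.cong) auto
      also have "\<dots> = Y h $ j"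
        using c[OF j] j by (simp add: col[OF h] Y_def)
      finally show "(transpose_mat A *\<^sub>v X h) $ j = Y h $ j" .
    qed (simp add: A_def Y_def)
    moreover have "A *\<^sub>v Y h = X h"
    proof (rule eq_vecI)
      fix i
      assume "i < dim_vec (X h)"
      then have i: "i < n"
        by (simp add: X_def)
      have "(A *\<^sub>v Y h) $ i = (\<Sum>j<n. W i j / (r i * c j) * (c j * h (Inr j)))"
        using i by (simp add: A_def Y_def scalar_prod_def lessThan_atLeast0)
      also have "\<dots> = (\<Sum>j<n. W i j * h (Inr j)) / r i"
        unfolding sum_divide_distrib by (intro sum.cong) auto
      also have "\<dots> = X h $ i"
        using r[OF i] i by (simp add: row[OF h] X_def)
      finally show "(A *\<^sub>v Y h) $ i = X h $ i" .
    qed (simp add: A_def X_def)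
    ultimately show ?thesis
      using A X by (simp add: assoc_mult_mat_vec[of _ n n _ n])
  qed
  \<comment> \<open>A linear relation between \<open>f\<close> and \<open>g\<close> on the rows
    passes to the columns through the column equations, because \<open>d\<close> is positive. So
    dependent row parts would make \<open>f\<close> and \<open>g\<close> dependent on all of
    \<open>?V\<close>.\<close>
  have "\<exists>i<n. \<exists>j<n. X f $ i * X g $ j \<noteq> X f $ j * X g $ i"
  proof (rule ccontr)
    assume neg: "\<not> ?thesis"
    have minor: "f (Inl i) * g (Inl j) = f (Inl j) * g (Inl i)" if "i < n" "j < n" for i j
    proof -
      have "X f $ i * X g $ j = X f $ j * X g $ i"
        using neg that by blast
      then have "(r i * r j) * (f (Inl i) * g (Inl j)) = (r i * r j) * (f (Inl j) * g (Inl i))"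
        using that by (simp add: X_def mult_ac)
      then show ?thesis
        using r(1)[OF that(1)] r(1)[OF that(2)] by simp
    qed
    \<comment> \<open>The coefficients are the values of \<open>g\<close> and \<open>f\<close> at a
      row where they are not both 0. If there is no such row, any pair serves.\<close>
    obtain \<alpha> \<beta> where \<alpha>\<beta>: "\<alpha> \<noteq> 0 \<or> \<beta> \<noteq> 0" and L: "\<And>i. i < n \<Longrightarrow> \<alpha> * f (Inl i) = \<beta> * g (Inl i)"
    proof (cases "\<exists>k<n. f (Inl k) \<noteq> 0 \<or> g (Inl k) \<noteq> 0")
      case True
      then obtain k where "k < n" "g (Inl k) \<noteq> 0 \<or> f (Inl k) \<noteq> 0"
        by auto
      then show thesis
        by (intro that[of "g (Inl k)" "f (Inl k)"]) (auto simp: minor mult.commute)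
    next
      case False
      then show thesis
        by (intro that[of 1 0]) auto
    qed
    have R: "\<alpha> * f (Inr j) = \<beta> * g (Inr j)" if "j < n" for j
    proof -
      have "d (Inr j) * (\<alpha> * f (Inr j)) = \<alpha> * (\<Sum>i<n. W i j * f (Inl i))"
        by (simp add: col[OF f_null that])
      also have "\<dots> = (\<Sum>i<n. W i j * (\<alpha> * f (Inl i)))"
        by (simp add: sum_distrib_left mult.left_commute)
      also have "\<dots> = (\<Sum>i<n. W i j * (\<beta> * g (Inl i)))"
        using L by simp
      also have "\<dots> = \<beta> * (\<Sum>i<n. W i j * g (Inl i))"
        by (simp add: sum_distrib_left mult.left_commute)
      also have "\<dots> = d (Inr j) * (\<beta> * g (Inr j))"
        by (simp add: col[OF g_null that])
      finally show ?thesis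
        using d_pos[of "Inr j"] that by simp
    qed
    have all: "\<alpha> * f v = \<beta> * g v" if "v \<in> ?V" for v
      using that L R by auto
    have "f u * g v = f v * g u" if "u \<in> ?V" "v \<in> ?V" for u v
    proof (cases "\<alpha> = 0")
      case True
      then show ?thesis using all[OF that(1)] all[OF that(2)] \<alpha>\<beta> by simp
    next
      case False
      have "\<alpha> * (f u * g v) = \<alpha> * (f v * g u)"
        using all[OF that(1)] all[OF that(2)] by (simp add: mult.assoc[symmetric])
      with False show ?thesis by simp
    qed
    with indep show False by auto
  qed
  then obtain i j where "i < n" "j < n" "X f $ i * X g $ j \<noteq> X f $ j * X g $ i"
    by auto
  moreover have AA: "A * transpose_mat A \<in> carrier_mat n n"
    using A by simp
  ultimately have ord: "2 \<le> order 1 (char_poly (A * transpose_mat A))"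
    using two_le_order_char_poly[OF AA _ X eigen[OF f_null] X eigen[OF g_null]] by simp
  have "char_poly (A * transpose_mat A) \<noteq> 0"
    using degree_monic_char_poly[OF AA] by auto
  with ord have "replicate_mset 2 1 \<subseteq># proots (char_poly (A * transpose_mat A))"
    by (simp add: count_le_replicate_mset_subset_eq[symmetric])
  then have "2 \<le> count (singular_values A) 1"
    unfolding singular_values_def
    using image_mset_subseteq_mono[of "replicate_mset 2 1" _ sqrt]
    by (simp add: count_le_replicate_mset_subset_eq)
  moreover have "has_pattern A P"
    unfolding has_pattern_def
  proof (intro conjI allI impI)
    show "A \<in> carrier_mat (dim_row P) (dim_col P)"
      using A P by simp
    fix i j
    assume "i < dim_row P" "j < dim_col P"
    then have "i < n" "j < n"
      using P by auto
    then show "A $$ (i, j) \<noteq> 0 \<longleftrightarrow> P $$ (i, j) = 1"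
      using r(1)[of i] c(1)[of j] w_supp[of "Inl i" "Inr j"] by (simp add: A_def W_def)
  qed
  ultimately show thesis
    using that by blast
qed

section \<open>Paths\<close>

text \<open>No edge leaves a longest path, so connectedness makes it spanning; a chord would close a
  cycle, which bridges exclude.\<close>

lemma spanning_path_if_bridges_and_degree_le_2:
  fixes V :: "'v set" and adj :: "'v \<Rightarrow> 'v \<Rightarrow> bool"
  assumes V: "finite V" "V \<noteq> {}" and adj: "symp adj" "\<And>v. \<not> adj v v"
    and conn: "\<And>C. C \<subseteq> V \<Longrightarrow> C \<noteq> {} \<Longrightarrow> C \<noteq> V \<Longrightarrow> \<exists>u\<in>C. \<exists>v\<in>V - C. adj u v"
    and bridge: "\<And>u v. u \<in> V \<Longrightarrow> v \<in> V \<Longrightarrow> adj u v \<Longrightarrow>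
      \<exists>C\<subseteq>V. u \<in> C \<and> v \<notin> C \<and> (\<forall>x\<in>C. \<forall>y\<in>V - C. adj x y \<longrightarrow> x = u \<and> y = v)"
    and deg: "\<And>v a b c. v \<in> V \<Longrightarrow> {a, b, c} \<subseteq> V \<Longrightarrow> adj v a \<Longrightarrow> adj v b \<Longrightarrow> adj v c \<Longrightarrow>
      a = b \<or> a = c \<or> b = c"
  obtains vs where "vs \<noteq> []" "distinct vs" "set vs = V"
    "\<And>i j. i < length vs \<Longrightarrow> j < length vs \<Longrightarrow> adj (vs ! i) (vs ! j) \<longleftrightarrow> j = Suc i \<or> i = Suc j"
proof -
  have sym: "adj u v \<longleftrightarrow> adj v u" for u v
    using adj(1) by (auto dest: sympD)
  let ?P = "\<lambda>vs. vs \<noteq> [] \<and> distinct vs \<and> set vs \<subseteq> V \<and> successively adj vs"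
  obtain x where "x \<in> V"
    using V by auto
  then have "?P [x]"
    by simp
  moreover have "\<forall>vs. ?P vs \<longrightarrow> length vs < Suc (card V)"
    using V(1) by (auto simp: distinct_card[symmetric] less_Suc_eq_le intro: card_mono)
  ultimately have "\<exists>vs. ?P vs \<and> (\<forall>us. ?P us \<longrightarrow> length us \<le> length vs)"
    by (rule ex_has_greatest_nat[of ?P "[x]" length "Suc (card V)"])
  then obtain vs where vs: "?P vs" and longest: "\<And>us. ?P us \<Longrightarrow> length us \<le> length vs"
    by (elim exE conjE) (rule that, auto)
  have consec: "adj (vs ! i) (vs ! Suc i)" if "Suc i < length vs" for i
    using vs that by (auto simp: successively_conv_nth)
  have nth_V: "vs ! i \<in> V" if "i < length vs" for i
    using vs that by (auto dest: nth_mem)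
  \<comment> \<open>At an end of the path, \<open>v\<close> would extend it; at an inner vertex it
    would be a third neighbour.\<close>
  have closed: False if "i < length vs" "v \<in> V - set vs" "adj (vs ! i) v" for i v
  proof -
    consider "i = 0" | "Suc i = length vs" | k where "i = Suc k" "Suc i < length vs"
      using \<open>i < length vs\<close> by (metis Suc_lessI not0_implies_Suc)
    then show False
    proof cases
      case 1
      then have "?P (v # vs)"
        using that vs sym by (auto simp: successively_Cons hd_conv_nth)
      then show False
        using longest[of "v # vs"] by simp
    next
      case 2
      then have "vs ! i = last vs"
        using vs by (metis diff_Suc_1 last_conv_nth)
      then have "?P (vs @ [v])"
        using that vs by (auto simp: successively_append_iff)
      then show False
        using longest[of "vs @ [v]"] by simp
    next
      case 3
      have "vs ! k = vs ! Suc i \<or> vs ! k = v \<or> vs ! Suc i = v"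
        using that 3 consec[of k] consec[of i] sym nth_V
        by (intro deg[of "vs ! i"]) auto
      then show False
        using that 3 vs by (auto simp: nth_eq_iff_index_eq)
    qed
  qed
  have "set vs = V"
  proof (rule ccontr)
    assume "set vs \<noteq> V"
    then obtain u v where "u \<in> set vs" "v \<in> V - set vs" "adj u v"
      using conn[of "set vs"] vs by auto
    then show False
      using closed by (metis in_set_conv_nth)
  qed
  have chord: "j = Suc i" if ij: "i < j" "j < length vs" "adj (vs ! i) (vs ! j)" for i j
  proof (rule ccontr)
    assume "j \<noteq> Suc i"
    obtain C where C: "vs ! i \<in> C" "vs ! j \<notin> C"
        "\<And>x y. x \<in> C \<Longrightarrow> y \<in> V - C \<Longrightarrow> adj x y \<Longrightarrow> x = vs ! i \<and> y = vs ! j"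
      using bridge[of "vs ! i" "vs ! j"] ij nth_V by (metis order.strict_trans)
    \<comment> \<open>The path starts in \<open>C\<close> at \<open>vs ! i\<close> and can leave
      \<open>C\<close> only along the chord, which is not one of its steps. So it stays in
      \<open>C\<close> up to \<open>vs ! j\<close>, which lies outside.\<close>
    have "vs ! k \<in> C" if "i \<le> k" "k \<le> j" for k
      using that
    proof (induction k rule: dec_induct)
      case (step k)
      have k: "Suc k < length vs"
        using step ij by simp
      show ?case
      proof (rule ccontr)
        assume "vs ! Suc k \<notin> C"
        then have "vs ! k = vs ! i \<and> vs ! Suc k = vs ! j"
          using C(3)[of "vs ! k" "vs ! Suc k"] step k consec nth_V by auto
        then have "k = i" "Suc k = j"
          using vs k ij by (auto simp: nth_eq_iff_index_eq)
        with \<open>j \<noteq> Suc i\<close> show False by simp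
      qed
    qed (use C in simp)
    with C ij show False by auto
  qed
  show thesis
  proof (rule that[of vs])
    show "adj (vs ! i) (vs ! j) \<longleftrightarrow> j = Suc i \<or> i = Suc j"
      if "i < length vs" "j < length vs" for i j
      using that chord[of i j] chord[of j i] consec[of i] consec[of j] sym adj(2)
      by (cases i j rule: linorder_cases) auto
  qed (use vs \<open>set vs = V\<close> in auto)
qed

section \<open>From the bipartite graph of the pattern to the underlying graph of its
  digraph\<close>

lemma parcs_mk_symmetric_pattern_digraph:
  "parcs (mk_symmetric (with_proj (pattern_digraph P))) =
    {(i, j). i < dim_row P \<and> j < dim_row P \<and> i \<noteq> j \<and> (P $$ (i, j) = 1 \<or> P $$ (j, i) = 1)}"
proof -
  let ?A = "{(i, j). i < dim_row P \<and> j < dim_row P \<and> i \<noteq> j \<and> P $$ (i, j) = 1}"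
  have "parcs (mk_symmetric (with_proj (pattern_digraph P))) = (\<Union>e\<in>?A. {(fst e, snd e), (snd e, fst e)})"
    by (simp add: parcs_mk_symmetric pattern_digraph_def)
  also have "\<dots> = {(i, j). i < dim_row P \<and> j < dim_row P \<and> i \<noteq> j \<and> (P $$ (i, j) = 1 \<or> P $$ (j, i) = 1)}"
    by auto
  finally show ?thesis .
qed

text \<open>The diagonal entries match row \<open>k\<close> with column \<open>k\<close>, and
  contracting this matching turns the remaining edges of the bipartite graph into the arcs. Each
  hypothesis of the spanning path lemma comes from one of the degeneracy criteria.\<close>

lemma weak_path_if_not_degenerate:
  assumes P: "P \<in> carrier_mat n n" and n: "n \<ge> 1" and diag: "standard_form P"
    and not_deg: "\<not> degenerate ({..<n} <+> {..<n}) (bipartite_adj P)"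
  shows "weak_path (with_proj (pattern_digraph P))"
proof -
  let ?V = "{..<n}"
  let ?W = "?V <+> ?V"
  let ?E = "bipartite_adj P"
  let ?R = "\<lambda>i j. P $$ (i, j) = 1"
  define adj where "adj = (\<lambda>i j. i \<noteq> j \<and> (?R i j \<or> ?R j i))"
  have diag: "?R i i" if "i < n" for i
    using diag that P by (auto simp: standard_form_def)
  have E_sym: "?E u v \<longleftrightarrow> ?E v u" for u v
    using symp_bipartite_adj by (auto dest: sympD)
  have mem [simp]: "Inl i \<in> ?W \<longleftrightarrow> i < n" "Inr i \<in> ?W \<longleftrightarrow> i < n" for i :: nat
    by auto
  have irrefl: "\<not> ?E v v" for v
    by (cases v) auto
  have conn: "\<exists>u\<in>C. \<exists>v\<in>?V - C. adj u v" if C: "C \<subseteq> ?V" "C \<noteq> {}" "C \<noteq> ?V" for C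
  proof (rule ccontr)
    assume none: "\<not> ?thesis"
    have no_arc: "\<not> ?R u v \<and> \<not> ?R v u" if "u \<in> C" "v < n" "v \<notin> C" for u v
    proof -
      have "\<not> adj u v" "u \<noteq> v"
        using none that by auto
      then show ?thesis
        by (simp add: adj_def)
    qed
    obtain p q where "p \<in> C" "q \<in> ?V - C"
      using C by blast
    have "degenerate ?W ?E"
    proof (rule degenerate_if_disconnected[of _ _ "C <+> C" "Inl p" "Inl q"])
      show "\<exists>u\<in>?W. ?E v u" if "v \<in> ?W" for v
      proof (cases v)
        case (Inl i)
        then show ?thesis
          using that diag[of i] by (intro bexI[of _ "Inr i"]) auto
      next
        case (Inr i)
        then show ?thesis
          using that diag[of i] by (intro bexI[of _ "Inl i"]) auto
      qed
      show "\<not> ?E u v" if "u \<in> C <+> C" "v \<in> ?W - (C <+> C)" for u v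
        using that by (cases u; cases v) (auto simp: no_arc simp del: One_nat_def)
    qed (use C \<open>p \<in> C\<close> \<open>q \<in> ?V - C\<close> symp_bipartite_adj in auto)
    with not_deg show False by simp
  qed
  \<comment> \<open>The reverse arc is excluded as well: it would be a second edge across the cut,
    between column \<open>i\<close> and row \<open>j\<close>. This is the source of
    \<open>antisym\<close>.\<close>
  have arc_bridge: "\<exists>C\<subseteq>?V. i \<in> C \<and> j \<notin> C \<and> \<not> ?R j i \<and> (\<forall>x\<in>C. \<forall>y\<in>?V - C. adj x y \<longrightarrow> x = i \<and> y = j)"
    if ij: "i < n" "j < n" "i \<noteq> j" "?R i j" for i j
  proof -
    have "\<exists>C\<subseteq>?W. Inl i \<in> C \<and> Inr j \<notin> C \<and>
      (\<forall>u\<in>C. \<forall>v\<in>?W - C. ?E u v \<longrightarrow> u = Inl i \<and> v = Inr j)"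
    proof (rule ccontr)
      assume none: "\<not> ?thesis"
      have "degenerate ?W ?E"
      proof (rule degenerate_if_not_bridge[of _ _ "Inl i" "Inr j"])
        show "\<exists>u\<in>?W - {Inl i, Inr j}. ?E (Inl i) u"
          using ij diag by (intro bexI[of _ "Inr i"]) auto
        show "\<exists>u\<in>?W - {Inl i, Inr j}. ?E (Inr j) u"
          using ij diag by (intro bexI[of _ "Inl j"]) auto
        show "\<exists>u\<in>C. \<exists>v\<in>?W - C. ?E u v \<and> (u \<noteq> Inl i \<or> v \<noteq> Inr j)"
          if "C \<subseteq> ?W" "Inl i \<in> C" "Inr j \<notin> C" for C
          using none that by blast
      qed (use ij irrefl symp_bipartite_adj in auto)
      with not_deg show False by simp
    qed
    then obtain C where C: "C \<subseteq> ?W" "Inl i \<in> C" "Inr j \<notin> C"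
        "\<And>u v. u \<in> C \<Longrightarrow> v \<in> ?W - C \<Longrightarrow> ?E u v \<Longrightarrow> u = Inl i \<and> v = Inr j"
      by blast
    \<comment> \<open>The only edge leaving \<open>C\<close> joins row \<open>i\<close> to column
      \<open>j\<close> with \<open>i \<noteq> j\<close>, so no diagonal edge is cut and
      \<open>C\<close> comes from a set of vertices of the digraph.\<close>
    have pair: "Inl k \<in> C \<longleftrightarrow> Inr k \<in> C" if "k < n" for k
      using C(4)[of "Inl k" "Inr k"] C(4)[of "Inr k" "Inl k"] that ij diag by auto
    define D where "D = {k. k < n \<and> Inl k \<in> C}"
    have D: "k \<in> D \<longleftrightarrow> Inl k \<in> C" "k \<in> D \<longleftrightarrow> Inr k \<in> C" if "k < n" for k
      using that pair by (auto simp: D_def)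
    have no_in: "\<not> ?R y x" if "x \<in> D" "y \<in> ?V - D" for x y
      using that D[of x] D[of y] C(4)[of "Inr x" "Inl y"] by (auto simp: D_def)
    have out: "x = i \<and> y = j" if "x \<in> D" "y \<in> ?V - D" "?R x y" for x y
      using that D[of x] D[of y] C(4)[of "Inl x" "Inr y"] by (auto simp: D_def)
    have "i \<in> D" "j \<in> ?V - D"
      using D[of i] D[of j] C(2,3) ij by auto
    moreover have "x = i \<and> y = j" if "x \<in> D" "y \<in> ?V - D" "adj x y" for x y
      using no_in[OF that(1,2)] out[OF that(1,2)] that(3) by (simp add: adj_def)
    moreover have "D \<subseteq> ?V"
      by (auto simp: D_def)
    ultimately show ?thesis
      using no_in[of i j] by blast
  qed
  have antisym: "i = j" if "i \<in> ?V" "j \<in> ?V" "?R i j" "?R j i" for i j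
    using arc_bridge[of i j] that by auto
  have bridge: "\<exists>C\<subseteq>?V. i \<in> C \<and> j \<notin> C \<and> (\<forall>x\<in>C. \<forall>y\<in>?V - C. adj x y \<longrightarrow> x = i \<and> y = j)"
    if ij: "i \<in> ?V" "j \<in> ?V" "adj i j" for i j
  proof (cases "?R i j")
    case True
    then have "i < n" "j < n" "i \<noteq> j" "?R i j"
      using ij by (auto simp: adj_def)
    from arc_bridge[OF this] show ?thesis
      by blast
  next
    case False
    then have "j < n" "i < n" "j \<noteq> i" "?R j i"
      using ij by (auto simp: adj_def)
    from arc_bridge[OF this] obtain C where C: "C \<subseteq> ?V" "j \<in> C" "i \<notin> C"
        "\<And>x y. x \<in> C \<Longrightarrow> y \<in> ?V - C \<Longrightarrow> adj x y \<Longrightarrow> x = j \<and> y = i"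
      by blast
    \<comment> \<open>Only the arc from \<open>j\<close> to \<open>i\<close> is present, so the
      complement of its cut gives the orientation wanted.\<close>
    have "x = i \<and> y = j" if "x \<in> ?V - C" "y \<in> ?V - (?V - C)" "adj x y" for x y
      using C(4)[of y x] that by (auto simp: adj_def)
    moreover have "i \<in> ?V - C" "j \<notin> ?V - C" "?V - C \<subseteq> ?V"
      using C(2,3) ij by auto
    ultimately show ?thesis
      by blast
  qed
  have no_claw: False
    if mem: "{v, a, b, c} \<subseteq> ?V" and nbrs: "?R v a \<and> ?R v b \<or> ?R a v \<and> ?R b v" "adj v c"
      and distinct: "distinct [v, a, b, c]" for v a b c
    using nbrs(1)
  proof
    assume R: "?R v a \<and> ?R v b"
    have "degenerate (Inl ` ?V \<union> Inr ` ?V) ?E"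
    proof (rule degenerate_if_claw[where R = ?R and adj = adj and v = v and a = a and b = b and c = c])
      show "symp ?E"
        by (rule symp_bipartite_adj)
      show "i = j" if "i \<in> ?V" "j \<in> ?V" "?R i j" "?R j i" for i j
        by (rule antisym[OF that])
      show "\<exists>u\<in>C. \<exists>v\<in>?V - C. adj u v" if "C \<subseteq> ?V" "C \<noteq> {}" "C \<noteq> ?V" for C
        by (rule conn[OF that])
      show "\<exists>C\<subseteq>?V. i \<in> C \<and> j \<notin> C \<and> (\<forall>x\<in>C. \<forall>y\<in>?V - C. adj x y \<longrightarrow> x = i \<and> y = j)"
        if "i \<in> ?V" "j \<in> ?V" "adj i j" for i j
        by (rule bridge[OF that])
    qed (use mem distinct nbrs(2) R diag in \<open>simp_all add: adj_def\<close>)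
    then show False
      using not_deg by (simp add: Plus_def)
  next
    \<comment> \<open>Two arcs entering \<open>v\<close> are two arcs leaving it in the transposed
      pattern, so rows and columns change places.\<close>
    assume R: "?R a v \<and> ?R b v"
    have "degenerate (Inr ` ?V \<union> Inl ` ?V) ?E"
    proof (rule degenerate_if_claw[where R = "\<lambda>i j. ?R j i" and adj = adj and v = v and a = a and b = b and c = c])
      show "adj i j \<longleftrightarrow> i \<noteq> j \<and> (?R j i \<or> ?R i j)" for i j
        by (auto simp: adj_def)
      show "symp ?E"
        by (rule symp_bipartite_adj)
      show "i = j" if "i \<in> ?V" "j \<in> ?V" "?R j i" "?R i j" for i j
        by (rule antisym[OF that(1,2,4,3)])
      show "\<exists>u\<in>C. \<exists>v\<in>?V - C. adj u v" if "C \<subseteq> ?V" "C \<noteq> {}" "C \<noteq> ?V" for C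
        by (rule conn[OF that])
      show "\<exists>C\<subseteq>?V. i \<in> C \<and> j \<notin> C \<and> (\<forall>x\<in>C. \<forall>y\<in>?V - C. adj x y \<longrightarrow> x = i \<and> y = j)"
        if "i \<in> ?V" "j \<in> ?V" "adj i j" for i j
        by (rule bridge[OF that])
      show "adj v c"
        by (rule nbrs(2))
    qed (use mem distinct R diag in simp_all)
    then show False
      using not_deg by (simp add: Plus_def Un_commute)
  qed
  have adj_sym: "adj i j \<longleftrightarrow> adj j i" for i j
    by (auto simp: adj_def)
  \<comment> \<open>Among three neighbours of \<open>v\<close>, two are joined to it by arcs of the
    same direction; \<open>no_claw\<close> is applied with the third one last.\<close>
  have deg: "a = b \<or> a = c \<or> b = c"
    if "v \<in> ?V" "{a, b, c} \<subseteq> ?V" "adj v a" "adj v b" "adj v c" for v a b c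
  proof (rule ccontr)
    assume "\<not> ?thesis"
    then show False
      using that no_claw[of v a b c] no_claw[of v a c b] no_claw[of v b c a] by (auto simp: adj_def)
  qed
  obtain vs where vs: "vs \<noteq> []" "distinct vs" "set vs = ?V"
    and nth: "\<And>i j. i < length vs \<Longrightarrow> j < length vs \<Longrightarrow> adj (vs ! i) (vs ! j) \<longleftrightarrow> j = Suc i \<or> i = Suc j"
  proof (rule spanning_path_if_bridges_and_degree_le_2[of ?V adj])
    show "finite ?V" "?V \<noteq> {}"
      using n by (auto simp: lessThan_empty_iff)
    show "symp adj" "\<not> adj v v" for v
      using adj_sym by (auto intro: sympI simp: adj_def)
    show "\<exists>u\<in>C. \<exists>v\<in>?V - C. adj u v" if "C \<subseteq> ?V" "C \<noteq> {}" "C \<noteq> ?V" for C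
      by (rule conn[OF that])
    show "\<exists>C\<subseteq>?V. i \<in> C \<and> j \<notin> C \<and> (\<forall>x\<in>C. \<forall>y\<in>?V - C. adj x y \<longrightarrow> x = i \<and> y = j)"
      if "i \<in> ?V" "j \<in> ?V" "adj i j" for i j
      by (rule bridge[OF that])
    show "a = b \<or> a = c \<or> b = c"
      if "v \<in> ?V" "{a, b, c} \<subseteq> ?V" "adj v a" "adj v b" "adj v c" for v a b c
      by (rule deg[OF that])
  qed (rule that)
  have "parcs (mk_symmetric (with_proj (pattern_digraph P))) = {(i, j). i < n \<and> j < n \<and> adj i j}"
    using P by (simp add: parcs_mk_symmetric_pattern_digraph adj_def)
  also have "\<dots> = {(vs ! i, vs ! j) | i j. i < length vs \<and> j < length vs \<and> (j = Suc i \<or> i = Suc j)}"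
    (is "?L = ?R")
  proof (intro equalityI subsetI)
    fix x
    assume "x \<in> ?L"
    then obtain a b where ab: "x = (a, b)" "adj a b" "a \<in> set vs" "b \<in> set vs"
      unfolding vs(3) by auto
    then obtain i j where "i < length vs" "j < length vs" "a = vs ! i" "b = vs ! j"
      by (auto simp: in_set_conv_nth)
    then show "x \<in> ?R"
      using ab(1,2) nth[of i j] by (intro CollectI exI[of _ i] exI[of _ j] conjI) simp_all
  next
    fix x
    assume "x \<in> ?R"
    then obtain i j where "x = (vs ! i, vs ! j)" "i < length vs" "j < length vs" "j = Suc i \<or> i = Suc j"
      by blast
    then show "x \<in> ?L"
      using nth[of i j] nth_mem[of i vs] nth_mem[of j vs] unfolding vs(3) by simp
  qed
  finally show ?thesis
    unfolding weak_path_def path_graph_def using vs P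
    by (intro exI[of _ vs] conjI) (simp_all add: pattern_digraph_def)
qed

theorem theorem2p10:
  fixes n :: nat and P :: "nat mat"
  assumes "n \<ge> 1"
    and "P \<in> carrier_mat n n"
    and "is_pattern P"
    and "term_rank P = n"
    and "standard_form P"
    and "\<And>A :: real mat. has_pattern A P \<Longrightarrow>
           (\<forall>\<sigma> \<in># singular_values A. count (singular_values A) \<sigma> = 1)"
  shows "weak_path (with_proj (pattern_digraph P))"
proof (rule weak_path_if_not_degenerate[OF assms(2,1,5)])
  show "\<not> degenerate ({..<n} <+> {..<n}) (bipartite_adj P)"
  proof
    assume "degenerate ({..<n} <+> {..<n}) (bipartite_adj P)"
    then obtain A where A: "has_pattern A P" "2 \<le> count (singular_values A) 1"
      using repeated_singular_value_if_degenerate[OF assms(2)] by blast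
    then have "1 \<in># singular_values A"
      by (simp add: count_greater_zero_iff[symmetric] del: count_greater_zero_iff)
    with assms(6)[OF A(1)] A(2) show False
      by auto
  qed
qed

end
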